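(* There exists a constant $c>0$ such that for all sufficiently large $n$ and all $0<\varepsilon\le 1$, \[ N_n(\varepsilon)\ge c\,\frac{n\log\log n}{\varepsilon}. \]
   Context: For $n\in\mathbb{N}$ and a prime $p$, $v_p(n!)$ denotes the exponent of $p$ in the prime factorization of $n!$. For each $n\in\mathbb{N}$ define $F_n(t)=\sum_{p\le n} v_p(n!)\,e^{ipt}$ for $t\in[-\pi,\pi]$, where the sum runs over primes $p\le n$. The associated planar curve is $\Gamma_n(t)=(\operatorname{Re}F_n(t),\operatorname{Im}F_n(t))\in\mathbb{R}^2$, $t\in[-\pi,\pi]$. For $\varepsilon>0$, $N_n(\varepsilon)$ is the minimal number of closed axis-aligned squares of side length $\varepsilon$ needed to cover the set $\Gamma_n([-\pi,\pi])\subset\mathbb{R}^2$. *)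

theory Defs
  imports "HOL-Analysis.Analysis" "HOL-Computational_Algebra.Primes"
begin

definition factorial_exp_sum :: "nat \<Rightarrow> real \<Rightarrow> complex" where
  "factorial_exp_sum n t =
     (\<Sum>p | prime p \<and> p \<le> n.
        of_nat (multiplicity p (fact n :: nat)) * exp (\<i> * of_nat p * of_real t))"

definition factorial_curve :: "nat \<Rightarrow> real \<Rightarrow> real \<times> real" where
  "factorial_curve n t = (Re (factorial_exp_sum n t), Im (factorial_exp_sum n t))"

definition closed_squares :: "real \<Rightarrow> (real \<times> real) set set" where
  "closed_squares \<epsilon> = {{a..a + \<epsilon>} \<times> {b..b + \<epsilon>} | a b. True}"

text \<open>
  The infimum is an attained minimum as soon as some finite cover exists, i.e. for every
  bounded \<open>S\<close> and \<open>\<epsilon> > 0\<close>; without a finite cover the value is the default \<open>Inf {} = 0\<close>.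
\<close>
definition square_covering_number :: "(real \<times> real) set \<Rightarrow> real \<Rightarrow> nat" where
  "square_covering_number S \<epsilon> =
     Inf {card \<C> | \<C>. finite \<C> \<and> \<C> \<subseteq> closed_squares \<epsilon> \<and> S \<subseteq> \<Union>\<C>}"

definition curve_covering_number :: "nat \<Rightarrow> real \<Rightarrow> nat" where
  "curve_covering_number n \<epsilon> = square_covering_number (factorial_curve n ` {-pi..pi}) \<epsilon>"

end

theory Submission
  imports Defs "HOL-Computational_Algebra.Squarefree" "HOL-Real_Asymp.Real_Asymp"
begin

text \<open>
  The curve is connected, so its projection to the real axis contains the whole interval from
  \<open>Re F\<^sub>n(\<pi>)\<close> to \<open>Re F\<^sub>n(0)\<close>, and covering that interval by intervals of length \<open>\<epsilon>\<close> already
  takes at least \<open>(Re F\<^sub>n(0) - Re F\<^sub>n(\<pi>)) / \<epsilon>\<close> of them. The difference is twice the sum of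
  \<open>v\<^sub>p(n!) \<ge> \<lfloor>n/p\<rfloor> \<ge> n/(2p)\<close> over the odd primes \<open>p \<le> n\<close>, and the sum of \<open>1/p\<close> over
  \<open>p \<le> n\<close> is at least \<open>log log n - O(1)\<close>. The latter follows by writing each \<open>k \<le> n\<close> as a square
  times a squarefree number, which bounds the harmonic sum by \<open>\<zeta>(2)\<close> times the product of
  \<open>1 + 1/p\<close> over \<open>p \<le> n\<close>.
\<close>

section \<open>Lower bound for the sum of reciprocals of primes\<close>

lemma finite_primes_le: "finite {p::nat. prime p \<and> p \<le> n}"
  by (rule finite_subset[of _ "{..n}"]) auto

text \<open>Makes a squarefree number recoverable from its set of prime factors, so that squarefree
  parts can be encoded as sets of primes.\<close>

lemma squarefree_eq_prod_prime_factors: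
  fixes n :: nat
  assumes "squarefree n"
  shows "\<Prod>(prime_factors n) = n"
proof -
  have "n \<noteq> 0"
    using assms by (auto intro: Nat.gr0I)
  have "multiplicity p n = 1" if "p \<in> prime_factors n" for p
  proof -
    have "prime p" "multiplicity p n > 0"
      using that by (auto simp: prime_factors_multiplicity)
    moreover have "multiplicity p n \<le> 1"
      using squarefree_factorial_semiring''[OF \<open>n \<noteq> 0\<close>] assms \<open>prime p\<close> by auto
    ultimately show ?thesis
      by linarith
  qed
  then have "\<Prod>(prime_factors n) = (\<Prod>p\<in>prime_factors n. p ^ multiplicity p n)"
    by (intro prod.cong) auto
  also have "\<dots> = n"
    using prime_factorization_nat[of n] \<open>n \<noteq> 0\<close> by simp
  finally show ?thesis .
qed

lemma harm_le_sum_squares_mult_prod_primes: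
  "(harm n :: real) \<le> (\<Sum>j=1..n. 1 / real j ^ 2) * (\<Prod>p | prime p \<and> p \<le> n. 1 + 1 / real p)"
proof -
  define P where "P = {p::nat. prime p \<and> p \<le> n}"
  \<comment> \<open>\<open>g\<close> encodes \<open>k\<close> as the pair (j, A) with k = j^2 *
    \<Prod>A; \<open>w\<close> is the weight that gives this pair the value 1/k.\<close>
  define g where "g k = (square_part k, prime_factors (squarefree_part k))" for k :: nat
  define w where "w = (\<lambda>(j, A). 1 / real j ^ 2 * (\<Prod>p\<in>A. 1 / real p))"
  have [simp]: "finite P"
    unfolding P_def by (rule finite_primes_le)
  have sf: "\<Prod>(prime_factors (squarefree_part k)) = squarefree_part k" for k :: nat
    by (simp add: squarefree_eq_prod_prime_factors)
  have "inj_on g {1..n}"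
  proof (rule inj_onI)
    fix k l assume "g k = g l"
    then show "k = l"
      using sf[of k] sf[of l] by (metis g_def prod.inject squarefree_decomposition_unique)
  qed
  have range: "g ` {1..n} \<subseteq> {1..n} \<times> Pow P"
  proof
    fix x assume "x \<in> g ` {1..n}"
    then obtain k where k: "1 \<le> k" "k \<le> n" "x = g k"
      by auto
    have "square_part k dvd k"
      using square_part_square_dvd[of k] by (metis dvd_mult_left power2_eq_square)
    moreover have "squarefree_part k dvd k"
      using squarefree_decompose[of k] by (metis dvd_triv_left)
    moreover have "square_part k > 0"
      using k by (auto intro: Nat.gr0I)
    ultimately have "square_part k \<in> {1..n}" "p \<le> n" if "p dvd squarefree_part k" for p
      using k dvd_imp_le[of "square_part k" k] dvd_imp_le[OF dvd_trans[OF that], of k] by auto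
    then show "x \<in> {1..n} \<times> Pow P"
      using k by (auto simp: g_def P_def prime_factors_dvd)
  qed
  have w_g: "w (g k) = inverse (real k)" for k
  proof -
    have "real k = real (\<Prod>(prime_factors (squarefree_part k))) * real (square_part k) ^ 2"
      unfolding sf by (metis squarefree_decompose of_nat_mult of_nat_power)
    then show ?thesis
      by (simp add: w_def g_def prod_dividef divide_simps)
  qed
  have "harm n = (\<Sum>k\<in>{1..n}. w (g k))"
    unfolding w_g harm_def ..
  also have "\<dots> = sum w (g ` {1..n})"
    using \<open>inj_on g {1..n}\<close> by (simp add: sum.reindex)
  \<comment> \<open>The weights are nonnegative, so the image of \<open>g\<close> may be enlarged to
    the full product set, over which the sum factorises.\<close>
  also have "\<dots> \<le> sum w ({1..n} \<times> Pow P)"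
    using range by (intro sum_mono2) (auto simp: w_def intro!: mult_nonneg_nonneg prod_nonneg divide_nonneg_nonneg)
  also have "\<dots> = (\<Sum>j=1..n. 1 / real j ^ 2) * (\<Sum>A\<in>Pow P. \<Prod>p\<in>A. 1 / real p)"
    unfolding w_def by (simp add: sum_product sum.cartesian_product)
  \<comment> \<open>Expanding the product picks 1/p for the primes in A and 1 for all
    others.\<close>
  also have "(\<Sum>A\<in>Pow P. \<Prod>p\<in>A. 1 / real p) = (\<Prod>p\<in>P. 1 + 1 / real p)"
    using prod_add[of P "\<lambda>p. 1 / real p" "\<lambda>_. 1"] by (simp add: add.commute)
  finally show ?thesis
    unfolding P_def .
qed

lemma sum_inverse_primes_ge:
  "\<exists>C. \<forall>n\<ge>2. (\<Sum>p | prime p \<and> p \<le> n. 1 / real p) \<ge> ln (ln (real n)) - C"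
\<comment> \<open>The constant stays schematic until the end, where it becomes
  \<open>ln (pi ^ 2 / 6)\<close>, the logarithm of the bound for the sum of inverse squares.\<close>
proof (intro exI allI impI)
  fix n :: nat
  assume n: "n \<ge> 2"
  define P where "P = {p::nat. prime p \<and> p \<le> n}"
  have "(\<Sum>j=1..n. 1 / real j ^ 2) = (\<Sum>j<n. 1 / (real j + 1) ^ 2)"
    by (rule sum.reindex_bij_witness[of _ Suc "\<lambda>j. j - 1"]) (auto simp: add.commute)
  also have "\<dots> \<le> pi ^ 2 / 6"
    using sum_le_suminf[OF sums_summable[OF inverse_squares_sums], of "{..<n}"] sums_unique[OF inverse_squares_sums]
    by (simp add: add.commute)
  finally have squares: "(\<Sum>j=1..n. 1 / real j ^ 2) \<le> pi ^ 2 / 6" .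
  have "ln (real n) \<le> ln (real n + 1)"
    using n by simp
  also have "\<dots> \<le> harm n"
    by (rule ln_le_harm)
  also have "\<dots> \<le> (\<Sum>j=1..n. 1 / real j ^ 2) * (\<Prod>p\<in>P. 1 + 1 / real p)"
    unfolding P_def by (rule harm_le_sum_squares_mult_prod_primes)
  \<comment> \<open>1 + x \<le> exp x turns the product into the exponential of the prime
    sum.\<close>
  also have "\<dots> \<le> pi ^ 2 / 6 * (\<Prod>p\<in>P. exp (1 / real p))"
    by (intro mult_mono squares prod_mono prod_nonneg) auto
  also have "\<dots> = pi ^ 2 / 6 * exp (\<Sum>p\<in>P. 1 / real p)"
    unfolding P_def by (simp add: exp_sum finite_primes_le)
  finally have "ln (ln (real n)) \<le> ln (pi ^ 2 / 6 * exp (\<Sum>p\<in>P. 1 / real p))"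
    using n by (subst ln_le_cancel_iff) auto
  also have "\<dots> = ln (pi ^ 2 / 6) + (\<Sum>p\<in>P. 1 / real p)"
    by (subst ln_mult) auto
  finally show "(\<Sum>p | prime p \<and> p \<le> n. 1 / real p) \<ge> ln (ln (real n)) - ln (pi ^ 2 / 6)"
    by (simp add: P_def)
qed

section \<open>Exponents of primes in the factorial\<close>

lemma div_le_multiplicity_fact:
  fixes p n :: nat
  assumes "prime p"
  shows "n div p \<le> multiplicity p (fact n :: nat)"
proof -
  have "p > 0"
    using assms by (rule prime_gt_0_nat)
  \<comment> \<open>The multiples p, 2p, ..., (n div p)p are factors of n!, and each contributes at
    least one to the exponent of p.\<close>
  have "n div p = (\<Sum>k\<in>(*) p ` {1..n div p}. 1)"
    using \<open>p > 0\<close> by (subst sum.reindex) (auto intro: inj_onI)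
  also have "\<dots> \<le> (\<Sum>k\<in>(*) p ` {1..n div p}. multiplicity p k)"
    using assms \<open>p > 0\<close> by (intro sum_mono) (auto simp: Suc_le_eq prime_multiplicity_gt_zero_iff)
  also have "\<dots> \<le> (\<Sum>k\<in>{1..n}. multiplicity p k)"
  proof (rule sum_mono2)
    show "(*) p ` {1..n div p} \<subseteq> {1..n}"
      using \<open>p > 0\<close> by (auto simp: less_eq_div_iff_mult_less_eq mult.commute Suc_le_eq)
  qed auto
  also have "\<dots> = multiplicity p (fact n :: nat)"
    unfolding fact_prod using assms by (simp add: prime_elem_multiplicity_prod_distrib)
  finally show ?thesis .
qed

text \<open>As p \<le> n, the quotient q = \<open>n div p\<close> is at least 1, so n < pq + p \<le>
  2pq: rounding down loses at most a factor 2.\<close>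

lemma multiplicity_fact_ge:
  fixes p n :: nat
  assumes "prime p" "p \<le> n"
  shows "real (multiplicity p (fact n :: nat)) \<ge> real n / (2 * real p)"
proof -
  have "p > 0"
    using assms(1) by (rule prime_gt_0_nat)
  then have "n div p \<ge> 1"
    using assms(2) by (simp add: Suc_le_eq div_greater_zero_iff)
  then have "p \<le> p * (n div p)"
    by simp
  moreover have "n mod p < p" "p * (n div p) + n mod p = n"
    using \<open>p > 0\<close> by auto
  ultimately have "n \<le> 2 * p * (n div p)"
    by linarith
  also have "\<dots> \<le> 2 * p * multiplicity p (fact n :: nat)"
    using div_le_multiplicity_fact[OF assms(1)] by (rule mult_le_mono2)
  finally have "real n \<le> 2 * real p * real (multiplicity p (fact n :: nat))"
    by (metis of_nat_le_iff of_nat_mult of_nat_numeral)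
  then show ?thesis
    using \<open>p > 0\<close> by (simp add: divide_simps mult_ac)
qed

section \<open>Real parts at the parameters 0 and pi\<close>

lemma exp_ii_nat_pi: "exp (\<i> * of_nat k * of_real pi) = (-1) ^ k"
  by (metis exp_of_nat_mult exp_pi_i' mult.assoc mult.commute)

text \<open>At \<open>pi\<close> the term of p carries the sign (-1)^p: the term of 2 cancels in the
  difference, those of odd primes double.\<close>

lemma Re_factorial_exp_sum_diff:
  "Re (factorial_exp_sum n 0) - Re (factorial_exp_sum n pi) =
     2 * (\<Sum>p | prime p \<and> p \<le> n \<and> odd p. real (multiplicity p (fact n :: nat)))"
proof -
  let ?v = "\<lambda>p. real (multiplicity p (fact n :: nat))"
  have term_diff: "Re (of_nat m * 1) - Re (of_nat m * (-1) ^ p) = (if odd p then 2 * real m else 0)"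
    for m p :: nat
    by auto
  have "Re (factorial_exp_sum n 0) - Re (factorial_exp_sum n pi) =
      (\<Sum>p | prime p \<and> p \<le> n. if odd p then 2 * ?v p else 0)"
    unfolding factorial_exp_sum_def Re_sum exp_ii_nat_pi sum_subtractf[symmetric] term_diff[symmetric]
    by simp
  also have "\<dots> = (\<Sum>p\<in>{p. prime p \<and> p \<le> n} \<inter> {p. odd p}. 2 * ?v p)"
    by (simp add: sum.inter_restrict[OF finite_primes_le])
  also have "{p. prime p \<and> p \<le> n} \<inter> {p. odd p} = {p. prime p \<and> p \<le> n \<and> odd p}"
    by auto
  finally show ?thesis
    by (simp add: sum_distrib_left)
qed

text \<open>The 1/2 is the reciprocal of the missing prime 2; the doubling of the odd terms offsets
  the 2 in n/(2p).\<close>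

lemma Re_factorial_exp_sum_diff_ge:
  "Re (factorial_exp_sum n 0) - Re (factorial_exp_sum n pi) \<ge>
     real n * ((\<Sum>p | prime p \<and> p \<le> n. 1 / real p) - 1 / 2)"
proof -
  let ?P = "{p::nat. prime p \<and> p \<le> n}" and ?Q = "{p::nat. prime p \<and> p \<le> n \<and> odd p}"
  have "finite ?Q"
    by (rule finite_subset[OF _ finite_primes_le[of n]]) auto
  \<comment> \<open>Only an inclusion is claimed, so 2 can be inserted even if n < 2.\<close>
  have "(\<Sum>p\<in>?P. 1 / real p) \<le> (\<Sum>p\<in>insert 2 ?Q. 1 / real p)"
    using \<open>finite ?Q\<close> by (intro sum_mono2) (auto dest: primes_dvd_imp_eq[OF two_is_prime_nat])
  also have "\<dots> = 1 / 2 + (\<Sum>p\<in>?Q. 1 / real p)"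
    using \<open>finite ?Q\<close> by simp
  finally have "real n * ((\<Sum>p\<in>?P. 1 / real p) - 1 / 2) \<le> real n * (\<Sum>p\<in>?Q. 1 / real p)"
    by (intro mult_left_mono) auto
  also have "\<dots> = 2 * (\<Sum>p\<in>?Q. real n / (2 * real p))"
    by (simp add: sum_distrib_left)
  also have "\<dots> \<le> 2 * (\<Sum>p\<in>?Q. real (multiplicity p (fact n :: nat)))"
    by (intro mult_left_mono sum_mono multiplicity_fact_ge) auto
  finally show ?thesis
    unfolding Re_factorial_exp_sum_diff .
qed

section \<open>Covering numbers and projections\<close>

lemma continuous_factorial_curve: "continuous_on S (factorial_curve n)"
  unfolding factorial_curve_def factorial_exp_sum_def by (intro continuous_intros)

text \<open>Rules out the default value \<open>Inf {} = 0\<close>, for which no positive lower bound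
  could hold.\<close>

lemma compact_finite_square_cover:
  assumes "compact S" "\<epsilon> > 0"
  obtains \<C> where "finite \<C>" "\<C> \<subseteq> closed_squares \<epsilon>" "S \<subseteq> \<Union>\<C>"
proof -
  define U where "U = (\<lambda>(x, y). {x - \<epsilon>/2<..<x + \<epsilon>/2} \<times> {y - \<epsilon>/2<..<y + \<epsilon>/2})"
  \<comment> \<open>\<open>Q z\<close> is the closed square around the open square
    \<open>U z\<close>; its upper ends are written so as to match
    \<open>closed_squares\<close>.\<close>
  define Q where "Q = (\<lambda>(x, y). {x - \<epsilon>/2..x - \<epsilon>/2 + \<epsilon>} \<times> {y - \<epsilon>/2..y - \<epsilon>/2 + \<epsilon>})"
  have "open (U z)" for z
    by (cases z) (simp add: U_def open_Times)
  moreover have "z \<in> U z" for z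
    using assms(2) by (cases z) (simp add: U_def)
  then have "S \<subseteq> (\<Union>z\<in>S. U z)"
    by auto
  ultimately obtain T where T: "T \<subseteq> S" "finite T" "S \<subseteq> (\<Union>z\<in>T. U z)"
    by (rule compactE_image[OF assms(1)])
  have "U z \<subseteq> Q z" for z
    by (cases z) (auto simp: U_def Q_def)
  then have "S \<subseteq> \<Union>(Q ` T)"
    by (intro order_trans[OF T(3)] UN_mono) auto
  moreover have "Q z \<in> closed_squares \<epsilon>" for z
    unfolding Q_def closed_squares_def case_prod_unfold by blast
  then have "Q ` T \<subseteq> closed_squares \<epsilon>"
    by auto
  ultimately show ?thesis
    using T(2) by (intro that[of "Q ` T"]) auto
qed

text \<open>Each square projects to an interval of length \<epsilon>, and Lebesgue measure is
  subadditive.\<close>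

lemma square_cover_card_ge:
  assumes cover: "finite \<C>" "\<C> \<subseteq> closed_squares \<epsilon>" "S \<subseteq> \<Union>\<C>"
    and proj: "{a..b} \<subseteq> fst ` S" and "\<epsilon> > 0"
  shows "b - a \<le> real (card \<C>) * \<epsilon>"
proof -
  have meas: "fst ` Q \<in> fmeasurable lborel" "measure lborel (fst ` Q) = \<epsilon>" if "Q \<in> \<C>" for Q
  proof -
    obtain c d where "Q = {c..c + \<epsilon>} \<times> {d..d + \<epsilon>}"
      using \<open>Q \<in> \<C>\<close> cover(2) unfolding closed_squares_def by blast
    then have "fst ` Q = {c..c + \<epsilon>}"
      using \<open>\<epsilon> > 0\<close> by simp
    then show "fst ` Q \<in> fmeasurable lborel" "measure lborel (fst ` Q) = \<epsilon>"
      using \<open>\<epsilon> > 0\<close> by (simp_all add: fmeasurable_def)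
  qed
  have covered: "{a..b} \<subseteq> (\<Union>Q\<in>\<C>. fst ` Q)"
    using order_trans[OF proj image_mono[OF cover(3)]] by (simp add: image_Union)
  \<comment> \<open>If a > b, the interval is empty and the left side is negative.\<close>
  have "b - a \<le> measure lborel {a..b}"
    by (cases "a \<le> b") auto
  also have "\<dots> \<le> measure lborel (\<Union>Q\<in>\<C>. fst ` Q)"
    using covered cover(1) meas(1) by (intro measure_mono_fmeasurable fmeasurable.finite_UN) auto
  also have "\<dots> \<le> (\<Sum>Q\<in>\<C>. measure lborel (fst ` Q))"
    using cover(1) fmeasurableD[OF meas(1)] by (intro measure_UNION_le) auto
  also have "\<dots> = real (card \<C>) * \<epsilon>"
    using meas(2) by simp
  finally show ?thesis .
qed

lemma square_covering_number_ge:
  assumes "compact S" "connected S" "z \<in> S" "w \<in> S" "\<epsilon> > 0"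
  shows "(fst w - fst z) / \<epsilon> \<le> real (square_covering_number S \<epsilon>)"
proof -
  let ?N = "{card \<C> | \<C>. finite \<C> \<and> \<C> \<subseteq> closed_squares \<epsilon> \<and> S \<subseteq> \<Union>\<C>}"
  obtain \<C> where "finite \<C>" "\<C> \<subseteq> closed_squares \<epsilon>" "S \<subseteq> \<Union>\<C>"
    using assms(1,5) by (rule compact_finite_square_cover)
  then have "card \<C> \<in> ?N"
    by (intro CollectI exI[of _ \<C>]) simp
  then have "?N \<noteq> {}"
    by (metis empty_iff)
  \<comment> \<open>A nonempty set of naturals contains its infimum, so some cover attains the
    covering number.\<close>
  then have "square_covering_number S \<epsilon> \<in> ?N"
    unfolding square_covering_number_def by (rule Inf_nat_def1)
  then obtain \<C> where \<C>: "finite \<C>" "\<C> \<subseteq> closed_squares \<epsilon>" "S \<subseteq> \<Union>\<C>"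
      and card: "square_covering_number S \<epsilon> = card \<C>"
    by (elim CollectE exE conjE)
  have "connected (fst ` S)"
    using assms(2) by (intro connected_continuous_image continuous_intros)
  then have "{fst z..fst w} \<subseteq> fst ` S"
    using assms(3,4) by (intro connected_contains_Icc) auto
  then show ?thesis
    using square_cover_card_ge[OF \<C>] \<open>\<epsilon> > 0\<close> card by (simp add: divide_simps)
qed

lemma curve_covering_number_ge:
  assumes "\<epsilon> > 0"
  shows "(Re (factorial_exp_sum n 0) - Re (factorial_exp_sum n pi)) / \<epsilon> \<le> real (curve_covering_number n \<epsilon>)"
proof -
  have "(fst (factorial_curve n 0) - fst (factorial_curve n pi)) / \<epsilon> \<le> real (curve_covering_number n \<epsilon>)"
    unfolding curve_covering_number_def
    by (intro square_covering_number_ge compact_continuous_image connected_continuous_image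
        continuous_factorial_curve imageI assms) auto
  then show ?thesis
    by (simp add: factorial_curve_def)
qed

theorem theorem7p2:
  "\<exists>c::real. c > 0 \<and>
     (\<forall>\<^sub>F n::nat in sequentially. \<forall>\<epsilon>::real. 0 < \<epsilon> \<and> \<epsilon> \<le> 1 \<longrightarrow>
        real (curve_covering_number n \<epsilon>) \<ge> c * (real n * ln (ln (real n)) / \<epsilon>))"
proof (intro exI conjI)
  obtain C where C: "\<forall>n\<ge>2. (\<Sum>p | prime p \<and> p \<le> n. 1 / real p) \<ge> ln (ln (real n)) - C"
    using sum_inverse_primes_ge ..
  \<comment> \<open>With L = ln (ln n), the threshold is exactly what makes L - C - 1/2 \<ge> L/2,
    which yields c = 1/2.\<close>
  have "\<forall>\<^sub>F n::nat in sequentially. ln (ln (real n)) \<ge> 2 * C + 1"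
    by real_asymp
  then show "\<forall>\<^sub>F n::nat in sequentially. \<forall>\<epsilon>::real. 0 < \<epsilon> \<and> \<epsilon> \<le> 1 \<longrightarrow>
      real (curve_covering_number n \<epsilon>) \<ge> 1 / 2 * (real n * ln (ln (real n)) / \<epsilon>)"
    using eventually_ge_at_top[of 2]
  proof eventually_elim
    case (elim n)
    have "1 / 2 * ln (ln (real n)) \<le> (\<Sum>p | prime p \<and> p \<le> n. 1 / real p) - 1 / 2"
      using C[rule_format, of n] elim by linarith
    then have "real n * (1 / 2 * ln (ln (real n))) \<le>
        real n * ((\<Sum>p | prime p \<and> p \<le> n. 1 / real p) - 1 / 2)"
      by (intro mult_left_mono) auto
    also note Re_factorial_exp_sum_diff_ge
    finally have diff: "1 / 2 * (real n * ln (ln (real n))) \<le>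
        Re (factorial_exp_sum n 0) - Re (factorial_exp_sum n pi)"
      by simp
    show ?case
    proof (intro allI impI)
      fix \<epsilon> :: real
      assume "0 < \<epsilon> \<and> \<epsilon> \<le> 1"
      then show "1 / 2 * (real n * ln (ln (real n)) / \<epsilon>) \<le> real (curve_covering_number n \<epsilon>)"
        using order_trans[OF divide_right_mono[OF diff, of \<epsilon>] curve_covering_number_ge[of \<epsilon> n]] by simp
    qed
  qed
qed simp

end
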